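(* Let $c$ be a positive integer and let $G$ be a triangle-free $4$-sunspot-free graph with $\chi(G)>2c+1$. Then $G$ has an induced subgraph $L$ with $\chi(L)=c+1$ that is non-degenerate, liberal, and flapless.
   Context: Graphs are finite and simple. A $4$-sunspot in $G$ is a $7$-tuple $(x_1,x_2,x_3,x_4;y_1,y_2,y_3)$ of pairwise distinct vertices such that the edges of $G$ among these seven vertices are exactly $x_1x_2,x_2x_3,x_3x_4,x_4x_1,x_1y_1,x_2y_2,x_3y_3$; $G$ is $4$-sunspot-free if there is no $4$-sunspot in $G$. A hole in $G$ is an induced subgraph that is a cycle on at least four vertices; its length is its number of edges. For a hole $H$, an $H$-flap is a hole of length $4$ in $G$ sharing at least one edge with $H$. A graph $G$ is non-degenerate if every vertex has degree at least $\chi(G)-1$; liberal if for all distinct non-adjacent vertices $x,y$, both $N(x)\setminus N(y)$ and $N(y)\setminus N(x)$ are nonempty; flapless if for every hole $H$ of length at least $6$ in $G$ there is no $H$-flap in $G$. *)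

theory Defs
  imports "Graph_Theory.Digraph_Component"
begin

text \<open>
  A finite simple graph is a \<^locale>\<open>pair_graph\<close>: a finite, loop-free, symmetric relation
  \<^const>\<open>parcs\<close> on a finite vertex set \<^const>\<open>pverts\<close>.  Each undirected edge is thus a
  pair of opposite arcs, and \<open>edges\<close> recovers the undirected edges.
\<close>

definition edges :: "'a pair_pre_digraph \<Rightarrow> 'a set set" where
  "edges G = {{u, v} |u v. (u, v) \<in> parcs G}"

definition neighbourhood :: "'a pair_pre_digraph \<Rightarrow> 'a \<Rightarrow> 'a set" where
  "neighbourhood G v = {w. (v, w) \<in> parcs G}"

definition degree :: "'a pair_pre_digraph \<Rightarrow> 'a \<Rightarrow> nat" where
  "degree G v = card (neighbourhood G v)"

definition proper_colouring :: "'a pair_pre_digraph \<Rightarrow> nat \<Rightarrow> ('a \<Rightarrow> nat) \<Rightarrow> bool" where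
  "proper_colouring G k \<phi> \<longleftrightarrow>
     (\<forall>v\<in>pverts G. \<phi> v < k) \<and> (\<forall>(u, v)\<in>parcs G. \<phi> u \<noteq> \<phi> v)"

definition chromatic_number :: "'a pair_pre_digraph \<Rightarrow> nat" where
  "chromatic_number G = (LEAST k. \<exists>\<phi>. proper_colouring G k \<phi>)"

definition triangle_free :: "'a pair_pre_digraph \<Rightarrow> bool" where
  "triangle_free G \<longleftrightarrow>
     \<not> (\<exists>x y z. (x, y) \<in> parcs G \<and> (y, z) \<in> parcs G \<and> (z, x) \<in> parcs G)"

definition four_sunspot ::
  "'a pair_pre_digraph \<Rightarrow> 'a \<Rightarrow> 'a \<Rightarrow> 'a \<Rightarrow> 'a \<Rightarrow> 'a \<Rightarrow> 'a \<Rightarrow> 'a \<Rightarrow> bool" where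
  "four_sunspot G x1 x2 x3 x4 y1 y2 y3 \<longleftrightarrow>
     {x1, x2, x3, x4, y1, y2, y3} \<subseteq> pverts G \<and>
     distinct [x1, x2, x3, x4, y1, y2, y3] \<and>
     {e \<in> edges G. e \<subseteq> {x1, x2, x3, x4, y1, y2, y3}} =
       {{x1, x2}, {x2, x3}, {x3, x4}, {x4, x1}, {x1, y1}, {x2, y2}, {x3, y3}}"

definition four_sunspot_free :: "'a pair_pre_digraph \<Rightarrow> bool" where
  "four_sunspot_free G \<longleftrightarrow>
     \<not> (\<exists>x1 x2 x3 x4 y1 y2 y3. four_sunspot G x1 x2 x3 x4 y1 y2 y3)"

text \<open>
  \<open>cycle_graph H\<close> says that the graph \<open>H\<close> itself is a cycle; the library's \<open>cycle\<close> is instead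
  a predicate on closed walks, which also admits going back and forth along one edge.
\<close>

definition cycle_graph :: "'a pair_pre_digraph \<Rightarrow> bool" where
  "cycle_graph H \<longleftrightarrow>
     (\<exists>n f. 3 \<le> n \<and> bij_betw f {..<n} (pverts H) \<and>
            edges H = {{f i, f (Suc i mod n)} |i. i < n})"

definition hole :: "'a pair_pre_digraph \<Rightarrow> 'a pair_pre_digraph \<Rightarrow> bool" where
  "hole G H \<longleftrightarrow> induced_subgraph (with_proj H) (with_proj G) \<and> cycle_graph H \<and> 4 \<le> card (pverts H)"

definition hole_length :: "'a pair_pre_digraph \<Rightarrow> nat" where
  "hole_length H = card (edges H)"

definition flap :: "'a pair_pre_digraph \<Rightarrow> 'a pair_pre_digraph \<Rightarrow> 'a pair_pre_digraph \<Rightarrow> bool" where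
  "flap G H F \<longleftrightarrow> hole G F \<and> hole_length F = 4 \<and> edges F \<inter> edges H \<noteq> {}"

text \<open>
  The truncated subtraction below is harmless: if \<open>G\<close> has a vertex, then
  \<open>chromatic_number G \<ge> 1\<close>.
\<close>

definition non_degenerate :: "'a pair_pre_digraph \<Rightarrow> bool" where
  "non_degenerate G \<longleftrightarrow> (\<forall>v\<in>pverts G. chromatic_number G - 1 \<le> degree G v)"

definition liberal :: "'a pair_pre_digraph \<Rightarrow> bool" where
  "liberal G \<longleftrightarrow>
     (\<forall>x\<in>pverts G. \<forall>y\<in>pverts G. x \<noteq> y \<and> (x, y) \<notin> parcs G \<longrightarrow>
        neighbourhood G x - neighbourhood G y \<noteq> {} \<and>
        neighbourhood G y - neighbourhood G x \<noteq> {})"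

definition flapless :: "'a pair_pre_digraph \<Rightarrow> bool" where
  "flapless G \<longleftrightarrow> (\<forall>H. hole G H \<and> 6 \<le> hole_length H \<longrightarrow> \<not> (\<exists>F. flap G H F))"

end

(* Assign to every vertex its distance to a root of its component.  If all distance levels were
   c-colourable, then G would be 2c-colourable, so some level contains a minimal set W that is not
   c-colourable; minimality makes L = G[W] non-degenerate and liberal.  As roots, and their
   neighbours by triangle-freeness, are stable, the level is at least 2: every w in W has a parent p
   one level down, and p has a neighbour q two levels down, hence without neighbours in W.
   If a 4-cycle of L shared an edge with a hole of L of length at least 6, then parents and their
   neighbours q would serve as pendant vertices of a 4-sunspot.  Only paths of consecutive
   vertices of the hole matter, and any five of these induce a path. *)

theory Submission
  imports Defs
begin

section \<open>Local structure around a long hole in a distance level\<close>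

text \<open>
  In \<open>no_sunspot\<close>, the non-edges not listed and the distinctness of the seven vertices follow from
  triangle-freeness; see \<open>four_sunspotI\<close>.
\<close>

locale sunspot_free_level =
  fixes E :: "'a \<Rightarrow> 'a \<Rightarrow> bool" and W :: "'a set"
  assumes sym: "E x y \<Longrightarrow> E y x"
    and no_common_neighbour: "E x y \<Longrightarrow> E y z \<Longrightarrow> \<not> E x z"
    and no_sunspot: "\<lbrakk>E x1 x2; E x2 x3; E x3 x4; E x4 x1; E x1 y1; E x2 y2; E x3 y3;
      \<not> E y1 x3; \<not> E y2 x4; \<not> E y3 x1; \<not> E y1 y2; \<not> E y2 y3; \<not> E y1 y3\<rbrakk> \<Longrightarrow> False"
    and parent_exists: "w \<in> W \<Longrightarrow> \<exists>p q. E p w \<and> E p q \<and> (\<forall>v\<in>W. \<not> E q v)"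
    and private_neighbour: "\<lbrakk>x \<in> W; y \<in> W; x \<noteq> y; \<not> E x y\<rbrakk> \<Longrightarrow> \<exists>z\<in>W. E x z \<and> \<not> E y z"
begin

text \<open>The vertex \<open>q\<close> supplies a pendant at \<open>p\<close> that misses all
  sunspot vertices taken from \<open>W\<close>. As \<open>q\<close> is chosen for \<open>p\<close>
  and not for \<open>w\<close>, being a parent passes to every neighbour of \<open>p\<close>, see
  \<open>parent_transfer\<close>.\<close>

definition parent :: "'a \<Rightarrow> 'a \<Rightarrow> bool" where
  "parent p w \<longleftrightarrow> E p w \<and> (\<exists>q. E p q \<and> (\<forall>v\<in>W. \<not> E q v))"

text \<open>An induced path; the listed adjacencies and non-adjacencies already force its five
  vertices to be distinct.\<close>

definition P5 :: "'a \<Rightarrow> 'a \<Rightarrow> 'a \<Rightarrow> 'a \<Rightarrow> 'a \<Rightarrow> bool" where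
  "P5 a b c d e \<longleftrightarrow> {a, b, c, d, e} \<subseteq> W \<and> E a b \<and> E b c \<and> E c d \<and> E d e \<and>
     \<not> E a c \<and> \<not> E a d \<and> \<not> E a e \<and> \<not> E b d \<and> \<not> E b e \<and> \<not> E c e"

lemma not_sym: "\<not> E x y \<Longrightarrow> \<not> E y x"
  using sym by blast

lemma P5_rev: "P5 a b c d e \<Longrightarrow> P5 e d c b a"
  unfolding P5_def using sym by auto

lemma P5D:
  assumes "P5 a b c d e"
  shows "a \<in> W" "b \<in> W" "c \<in> W" "d \<in> W" "e \<in> W" "E a b" "E b c" "E c d" "E d e"
    "\<not> E a c" "\<not> E a d" "\<not> E a e" "\<not> E b d" "\<not> E b e" "\<not> E c e"
  using assms unfolding P5_def by auto

lemma parentE: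
  assumes "parent p w"
  obtains q where "E p q" "\<And>v. v \<in> W \<Longrightarrow> \<not> E q v"
  using assms unfolding parent_def by blast

lemma parentD: "parent p w \<Longrightarrow> E p w"
  unfolding parent_def by auto

lemma obtain_parent:
  assumes "w \<in> W"
  obtains p where "parent p w"
  using parent_exists[OF assms] unfolding parent_def by blast

lemma parent_transfer: "parent p w \<Longrightarrow> E p v \<Longrightarrow> parent p v"
  unfolding parent_def by blast

text \<open>Otherwise the 4-cycle \<open>b p d c\<close> has the pendants \<open>a\<close>,
  \<open>q\<close>, \<open>e\<close> at \<open>b\<close>, \<open>p\<close>,
  \<open>d\<close>.\<close>

lemma parent_not_adj_distance_two:
  assumes P: "P5 a b c d e" and p: "parent p b"
  shows "\<not> E p d"
proof
  assume pd: "E p d"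
  obtain q where q: "E p q" "\<And>v. v \<in> W \<Longrightarrow> \<not> E q v"
    using parentE[OF p] by blast
  note F = P5D[OF P] q pd parentD[OF p]
  show False
    \<comment> \<open>The trailing \<open>rule F\<close> discharges the premise
      \<open>v \<in> W\<close> that is left when the fact applied is the one about
      \<open>q\<close>.\<close>
    by (rule no_sunspot[of b p d c a q e];
        ((rule F | rule sym, rule F | rule not_sym, rule F); rule F))
qed

lemma parent_not_adj_distance_two': "P5 a b c d e \<Longrightarrow> parent p d \<Longrightarrow> \<not> E p b"
  using parent_not_adj_distance_two P5_rev by blast

text \<open>An edge between the parents closes the 4-cycle \<open>d c p r\<close>, with pendants
  \<open>e\<close>, \<open>b\<close>, \<open>q\<close> at \<open>d\<close>, \<open>c\<close>,
  \<open>p\<close>. That \<open>p\<close> misses \<open>e\<close> and \<open>r\<close> misses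
  \<open>b\<close> comes from the previous two lemmas.\<close>

lemma parents_of_edge_not_adj:
  assumes P: "P5 a b c d e" "P5 b c d e f"
    and p: "parent p c" and r: "parent r d"
  shows "\<not> E p r"
proof
  assume pr: "E p r"
  obtain q where q: "E p q" "\<And>v. v \<in> W \<Longrightarrow> \<not> E q v"
    using parentE[OF p] by blast
  note F = P5D[OF P(1)] P5D[OF P(2)] q pr parentD[OF p] parentD[OF r]
    parent_not_adj_distance_two'[OF P(1) r] parent_not_adj_distance_two[OF P(2) p]
  show False
    by (rule no_sunspot[of d c p r e b q];
        ((rule F | rule sym, rule F | rule not_sym, rule F); rule F))
qed

text \<open>If \<open>x\<close> differs from \<open>c\<close>, then \<open>c\<close> has a neighbour
  \<open>y\<close> missed by \<open>x\<close>, and \<open>x\<close> has a neighbour \<open>w\<close>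
  missed by \<open>c\<close>. Sunspot-freeness then makes \<open>a\<close>, \<open>y\<close>,
  \<open>w\<close> a triangle.\<close>

lemma twin_on_hole:
  assumes P: "P5 z a b c d" "P5 a b c d e" "P5 b c d e f"
    and x: "x \<in> W" "E x b" "E x d"
  shows "x = c"
proof (rule ccontr)
  assume "x \<noteq> c"
  note F = P5D[OF P(1)] P5D[OF P(2)] P5D[OF P(3)] x
  have xc: "\<not> E x c"
    by (rule no_common_neighbour[of _ b];
        ((rule F | rule sym, rule F | rule not_sym, rule F); rule F))
  obtain p where p: "parent p c"
    using obtain_parent F by blast
  obtain q where q: "E p q" "\<And>v. v \<in> W \<Longrightarrow> \<not> E q v"
    using parentE[OF p] by blast
  note F = F xc q parentD[OF p]
    parent_not_adj_distance_two'[OF P(1) p] parent_not_adj_distance_two[OF P(3) p]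
  \<comment> \<open>Otherwise the 4-cycle \<open>b c d x\<close> has the pendants \<open>a\<close>,
    \<open>p\<close>, \<open>e\<close>.\<close>
  have px: "E p x"
  proof (rule ccontr)
    assume px: "\<not> E p x"
    note F = F px
    show False
      by (rule no_sunspot[of b c d x a p e];
          ((rule F | rule sym, rule F | rule not_sym, rule F); rule F))
  qed
  obtain y where y: "y \<in> W" "E c y" "\<not> E x y"
    using private_neighbour[OF P5D(3)[OF P(2)] x(1) _ not_sym[OF xc]] \<open>x \<noteq> c\<close> by blast
  obtain w where w: "w \<in> W" "E x w" "\<not> E c w"
    using private_neighbour[OF x(1) P5D(3)[OF P(2)] \<open>x \<noteq> c\<close> xc] by blast
  note F = F px y w
  \<comment> \<open>The 4-cycle on \<open>b\<close>, \<open>c\<close>, \<open>p\<close>,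
    \<open>x\<close> is used three times, with pendants \<open>y\<close>, \<open>q\<close>,
    \<open>w\<close>, then \<open>a\<close>, \<open>y\<close>, \<open>q\<close>, then
    \<open>a\<close>, \<open>w\<close>, \<open>q\<close>. Each use forces one edge of the
    triangle.\<close>
  have 1: "E y w"
  proof (rule ccontr)
    assume n: "\<not> E y w"
    note F = F n
    show False
      by (rule no_sunspot[of c p x b y q w];
          ((rule F | rule sym, rule F | rule not_sym, rule F); rule F))
  qed
  have 2: "E a y"
  proof (rule ccontr)
    assume n: "\<not> E a y"
    note F = F n
    show False
      by (rule no_sunspot[of b c p x a y q];
          ((rule F | rule sym, rule F | rule not_sym, rule F); rule F))
  qed
  have 3: "E a w"
  proof (rule ccontr)
    assume n: "\<not> E a w"
    note F = F n
    show False
      by (rule no_sunspot[of b x p c a w q];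
          ((rule F | rule sym, rule F | rule not_sym, rule F); rule F))
  qed
  show False
    using no_common_neighbour[OF 2 1] 3 by blast
qed

text \<open>Otherwise the 4-cycle \<open>p c d x\<close> has the pendants \<open>q\<close>,
  \<open>b\<close>, \<open>e\<close>. Later \<open>x\<close> is a vertex of a flap next to the hole
  edge \<open>c d\<close>.\<close>

lemma parent_of_hole_edge_end:
  assumes P: "P5 a b c d e" "P5 b c d e f"
    and x: "x \<in> W" "E d x" "\<not> E x b" and p: "parent p c"
  shows "\<not> E p x"
proof
  assume px: "E p x"
  obtain q where q: "E p q" "\<And>v. v \<in> W \<Longrightarrow> \<not> E q v"
    using parentE[OF p] by blast
  note F = P5D[OF P(1)] P5D[OF P(2)] x px q parentD[OF p] parent_not_adj_distance_two[OF P(2) p]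
  have bp: "\<not> E b p"
    by (rule no_common_neighbour[of _ c];
        ((rule F | rule sym, rule F | rule not_sym, rule F); rule F))
  note F = F bp
  show False
    by (rule no_sunspot[of p c d x q b e];
        ((rule F | rule sym, rule F | rule not_sym, rule F); rule F))
qed

text \<open>Here \<open>c d s t\<close> is the flap and \<open>c d\<close> its edge on the hole. In
  the end the parents \<open>p\<close>, \<open>r\<close>, \<open>u\<close> of \<open>c\<close>,
  \<open>d\<close>, \<open>s\<close> are pendants of a sunspot on the flap itself; everything before
  excludes unwanted adjacencies. The delicate pair is \<open>u\<close>, \<open>p\<close>, which is
  settled by first proving that \<open>u\<close> is adjacent to \<open>b\<close>.\<close>

lemma no_four_cycle_on_hole_edge:
  assumes P: "P5 z a b c d" "P5 a b c d e" "P5 b c d e f" "P5 c d e f g" "P5 d e f g h"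
    and x: "s \<in> W" "t \<in> W" "E d s" "E s t" "E t c" "s \<noteq> c" "t \<noteq> d"
  shows False
proof -
  have sb: "\<not> E s b"
    using twin_on_hole[OF P(1,2,3) x(1) _ sym[OF x(3)]] x(6) by blast
  have te: "\<not> E t e"
    using twin_on_hole[OF P(2,3,4) x(2) x(5)] x(7) by blast
  have sf: "\<not> E s f"
  proof
    assume "E s f"
    hence "s = e"
      using twin_on_hole[OF P(3,4,5) x(1) sym[OF x(3)]] by blast
    thus False
      using x(4) te sym by blast
  qed
  obtain p where p: "parent p c"
    using obtain_parent[OF P5D(3)[OF P(2)]] .
  obtain r where r: "parent r d"
    using obtain_parent[OF P5D(4)[OF P(2)]] .
  obtain u where u: "parent u s"
    using obtain_parent[OF x(1)] .
  obtain q where q: "E u q" "\<And>v. v \<in> W \<Longrightarrow> \<not> E q v"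
    using parentE[OF u] by blast
  obtain q' where q': "E r q'" "\<And>v. v \<in> W \<Longrightarrow> \<not> E q' v"
    using parentE[OF r] by blast
  have ps: "\<not> E p s"
    using parent_of_hole_edge_end[OF P(2,3) x(1,3) sb p] .
  have rt: "\<not> E r t"
    using parent_of_hole_edge_end[OF P5_rev[OF P(3)] P5_rev[OF P(2)] x(2) sym[OF x(5)] te r] .
  \<comment> \<open>If \<open>u\<close> were adjacent to \<open>c\<close>, it would be a parent of
    \<open>c\<close> and hence miss \<open>s\<close>.\<close>
  have uc: "\<not> E u c"
    using parent_of_hole_edge_end[OF P(2,3) x(1,3) sb parent_transfer[OF u]] parentD[OF u] by blast
  have pr: "\<not> E p r"
    using parents_of_edge_not_adj[OF P(2,3) p r] .
  note F = P5D[OF P(1)] P5D[OF P(2)] P5D[OF P(3)] x(1-5) sb te sf parentD[OF p] parentD[OF r]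
    parentD[OF u] q q' ps rt uc pr
  have ue: "\<not> E u e"
  proof
    assume n: "E u e"
    note F = F n
    show False
      by (rule no_sunspot[of u e d s q f c];
          ((rule F | rule sym, rule F | rule not_sym, rule F); rule F))
  qed
  note F = F ue
  \<comment> \<open>Now \<open>u\<close> is a parent of both \<open>s\<close> and \<open>b\<close>, so it is not adjacent to the parent \<open>p\<close> of \<open>c\<close>.\<close>
  have ub: "E u b"
  proof (rule ccontr)
    assume n: "\<not> E u b"
    note F = F n
    show False
      by (rule no_sunspot[of c d s t b e u];
          ((rule F | rule sym, rule F | rule not_sym, rule F); rule F))
  qed
  have up: "\<not> E u p"
    using parents_of_edge_not_adj[OF P(1,2) parent_transfer[OF u ub] p] .
  have ur: "\<not> E u r"
  proof
    assume n: "E u r"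
    note F = F n
    show False
      by (rule no_sunspot[of r d s u q' e t];
          ((rule F | rule sym, rule F | rule not_sym, rule F); rule F))
  qed
  note F = F up ur
  show False
    by (rule no_sunspot[of c d s t p r u];
        ((rule F | rule sym, rule F | rule not_sym, rule F); rule F))
qed

end

section \<open>Colourings of vertex sets\<close>

text \<open>The relation stays fixed while the set varies, so passing to a level or deleting a
  vertex changes only \<open>S\<close>. The link to \<open>proper_colouring\<close> is
  \<open>ex_proper_colouring_induced_iff\<close>.\<close>

definition colourable :: "('a \<Rightarrow> 'a \<Rightarrow> bool) \<Rightarrow> 'a set \<Rightarrow> nat \<Rightarrow> bool" where
  "colourable E S k \<longleftrightarrow> (\<exists>\<phi>. (\<forall>v\<in>S. \<phi> v < k) \<and> (\<forall>u\<in>S. \<forall>v\<in>S. E u v \<longrightarrow> \<phi> u \<noteq> \<phi> v))"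

lemma colourable_mono:
  assumes "colourable E S k" "k \<le> l"
  shows "colourable E S l"
proof -
  obtain \<phi> where \<phi>: "\<forall>v\<in>S. \<phi> v < k" "\<forall>u\<in>S. \<forall>v\<in>S. E u v \<longrightarrow> \<phi> u \<noteq> \<phi> v"
    using assms(1) unfolding colourable_def by (elim exE conjE)
  have "\<forall>v\<in>S. \<phi> v < l"
    using \<phi>(1) assms(2) by (meson order_less_le_trans)
  with \<phi>(2) show ?thesis
    unfolding colourable_def by (intro exI[of _ \<phi>] conjI)
qed

lemma colourable_stable:
  assumes "\<And>u v. u \<in> S \<Longrightarrow> v \<in> S \<Longrightarrow> \<not> E u v" and "0 < c"
  shows "colourable E S c"
  unfolding colourable_def by (rule exI[of _ "\<lambda>_. 0"]) (simp add: assms)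

text \<open>The extension step shared by the three facts on critical sets. They differ in the free
  colour \<open>i\<close>: one missing around the vertex, the colour of another vertex, or a new
  colour.\<close>

lemma colourable_insert:
  assumes sym: "symp E" and irrefl: "\<not> E w w"
    and \<phi>: "\<forall>v\<in>W - {w}. \<phi> v < k" "\<forall>u\<in>W - {w}. \<forall>v\<in>W - {w}. E u v \<longrightarrow> \<phi> u \<noteq> \<phi> v"
    and i: "i < k" "\<forall>v\<in>W. E w v \<longrightarrow> \<phi> v \<noteq> i"
  shows "colourable E W k"
  unfolding colourable_def
proof (intro exI[of _ "\<phi>(w := i)"] conjI ballI impI)
  fix v assume "v \<in> W"
  then show "(\<phi>(w := i)) v < k"
    using \<phi>(1) i(1) by auto
next
  fix u v assume "u \<in> W" "v \<in> W" "E u v"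
  then show "(\<phi>(w := i)) u \<noteq> (\<phi>(w := i)) v"
    using \<phi>(2) i(2) irrefl sympD[OF sym, of u v] by auto
qed

section \<open>Distance levels\<close>

text \<open>\<open>d\<close> is the distance to a chosen root of the component. The conjuncts are
  used, in this order, to confine edges to equal or consecutive levels, to find parents, and to see
  that levels 0 and 1 are stable.\<close>

lemma level_function:
  fixes E :: "'a \<Rightarrow> 'a \<Rightarrow> bool"
  assumes sym: "symp E"
    and tri: "\<forall>x y z. E x y \<longrightarrow> E y z \<longrightarrow> \<not> E x z"
  shows "\<exists>d :: 'a \<Rightarrow> nat. (\<forall>u v. E u v \<longrightarrow> d v \<le> Suc (d u)) \<and>
    (\<forall>v k. d v = Suc k \<longrightarrow> (\<exists>u. E u v \<and> d u = k)) \<and>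
    (\<forall>u v. E u v \<longrightarrow> d u = d v \<longrightarrow> 2 \<le> d u)"
proof -
  \<comment> \<open>\<open>rep\<close> depends only on the component, so it chooses one root per component.\<close>
  define R where "R = {(u, v). E u v}"
  define rep where "rep v = (SOME u. (u, v) \<in> R\<^sup>*)" for v
  define d where "d v = (LEAST k. (rep v, v) \<in> R ^^ k)" for v
  have rep_eq: "rep u = rep v" if "E u v" for u v
  proof -
    have "(u, v) \<in> R" "(v, u) \<in> R"
      using that sympD[OF sym that] by (auto simp: R_def)
    then have "(\<lambda>w. (w, u) \<in> R\<^sup>*) = (\<lambda>w. (w, v) \<in> R\<^sup>*)"
      by (auto intro: rtrancl_into_rtrancl)
    then show ?thesis
      by (simp add: rep_def)
  qed
  have "(rep v, v) \<in> R\<^sup>*" for v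
    unfolding rep_def by (rule someI[of _ v]) simp
  then have "\<exists>k. (rep v, v) \<in> R ^^ k" for v
    by (simp add: rtrancl_power)
  then have d: "(rep v, v) \<in> R ^^ d v" for v
    unfolding d_def by (rule LeastI_ex)
  have d_le: "d v \<le> k" if "(rep v, v) \<in> R ^^ k" for v k
    unfolding d_def using that by (rule Least_le)
  have step: "d v \<le> Suc (d u)" if "E u v" for u v
  proof (rule d_le)
    show "(rep v, v) \<in> R ^^ Suc (d u)"
      using d[of u] rep_eq[OF that] that by (auto simp: R_def)
  qed
  have pred: "\<exists>u. E u v \<and> d u = k" if v: "d v = Suc k" for v k
  proof -
    obtain u where u: "(rep v, u) \<in> R ^^ k" "(u, v) \<in> R"
      using relpow_Suc_E[OF d[of v, unfolded v]] .
    then have "E u v"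
      by (simp add: R_def)
    have "d u \<le> k"
      using d_le[of u k] u rep_eq[OF \<open>E u v\<close>] by simp
    then show ?thesis
      using step[OF \<open>E u v\<close>] v \<open>E u v\<close> by force
  qed
  have zero: "v = rep v" if "d v = 0" for v
    using d[of v] that by simp
  have "2 \<le> d u" if uv: "E u v" "d u = d v" for u v
  proof (rule ccontr)
    assume "\<not> 2 \<le> d u"
    then consider "d u = 0" "d v = 0" | "d u = Suc 0" "d v = Suc 0"
      using uv(2) by linarith
    then show False
    proof cases
      \<comment> \<open>Both ends equal the root of their component, and \<open>tri\<close> with
        three equal vertices excludes loops.\<close>
      case 1
      then have "u = v"
        using zero rep_eq[OF uv(1)] by metis
      then show False
        using uv(1) tri by blast
    next
      case 2
      \<comment> \<open>Both \<open>s\<close> and \<open>t\<close> are the root of the component,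
        which therefore forms a triangle with \<open>u\<close> and \<open>v\<close>.\<close>
      then obtain s t where st: "E s u" "d s = 0" "E t v" "d t = 0"
        using pred by blast
      then have "s = t"
        using zero rep_eq uv(1) by metis
      then show False
        using st uv(1) tri by blast
    qed
  qed
  with step pred show ?thesis
    by (intro exI[of _ d]) simp
qed

text \<open>Even levels take colours below \<open>c\<close> and odd levels those from
  \<open>c\<close> on. An edge between different levels joins levels of different parity.\<close>

lemma colourable_of_levels:
  fixes d :: "'a \<Rightarrow> nat"
  assumes sym: "symp E"
    and step: "\<And>u v. E u v \<Longrightarrow> d v \<le> Suc (d u)"
    and lev: "\<And>k. colourable E {v \<in> V. d v = k} c"
  shows "colourable E V (2 * c)"
proof -
  obtain \<phi> where "\<forall>k. (\<forall>v\<in>{v \<in> V. d v = k}. \<phi> k v < c) \<and>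
      (\<forall>u\<in>{v \<in> V. d v = k}. \<forall>v\<in>{v \<in> V. d v = k}. E u v \<longrightarrow> \<phi> k u \<noteq> \<phi> k v)"
    using choice[OF allI, of "\<lambda>k \<phi>. (\<forall>v\<in>{v \<in> V. d v = k}. \<phi> v < c) \<and>
      (\<forall>u\<in>{v \<in> V. d v = k}. \<forall>v\<in>{v \<in> V. d v = k}. E u v \<longrightarrow> \<phi> u \<noteq> \<phi> v)",
      OF lev[unfolded colourable_def]] by (elim exE)
  then have \<phi>: "\<And>k v. v \<in> V \<Longrightarrow> d v = k \<Longrightarrow> \<phi> k v < c"
    "\<And>k u v. u \<in> V \<Longrightarrow> v \<in> V \<Longrightarrow> d u = k \<Longrightarrow> d v = k \<Longrightarrow> E u v \<Longrightarrow> \<phi> k u \<noteq> \<phi> k v"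
    by auto
  show ?thesis
    unfolding colourable_def
  proof (intro exI[of _ "\<lambda>v. if even (d v) then \<phi> (d v) v else c + \<phi> (d v) v"] conjI ballI impI)
    fix v assume "v \<in> V"
    then show "(if even (d v) then \<phi> (d v) v else c + \<phi> (d v) v) < 2 * c"
      using \<phi>(1)[of v] by fastforce
  next
    fix u v assume uv: "u \<in> V" "v \<in> V" "E u v"
    have "d u = d v \<or> d u = Suc (d v) \<or> d v = Suc (d u)"
      using step[OF uv(3)] step[OF sympD[OF sym uv(3)]] by linarith
    then show "(if even (d u) then \<phi> (d u) u else c + \<phi> (d u) u) \<noteq>
        (if even (d v) then \<phi> (d v) v else c + \<phi> (d v) v)"
      using \<phi>(1)[OF uv(1) refl] \<phi>(1)[OF uv(2) refl] \<phi>(2)[OF uv(1,2) _ refl uv(3)] by auto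
  qed
qed

section \<open>Critical subsets\<close>

lemma critical_subset:
  assumes "finite V" "\<not> colourable E V c"
  obtains W where "W \<subseteq> V" "\<not> colourable E W c" "\<And>w. w \<in> W \<Longrightarrow> colourable E (W - {w}) c"
proof -
  have "\<exists>W\<subseteq>V. \<not> colourable E W c \<and> (\<forall>w\<in>W. colourable E (W - {w}) c)"
    using assms
  proof (induction V rule: finite_psubset_induct)
    case (psubset V)
    show ?case
    proof (cases "\<forall>w\<in>V. colourable E (V - {w}) c")
      case True
      then show ?thesis
        using psubset.prems by blast
    next
      case False
      then obtain w where "w \<in> V" "\<not> colourable E (V - {w}) c"
        by blast
      then show ?thesis
        using psubset.IH[of "V - {w}"] by blast
    qed
  qed
  then show thesis
    using that by blast
qed

text \<open>A level that is not \<open>c\<close>-colourable is not stable, so its index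
  \<open>k\<close> is at least 2. Two steps towards the root lead from \<open>w\<close> to
  \<open>p\<close> and \<open>q\<close>; since \<open>q\<close> lies in level \<open>k - 2\<close>,
  it has no neighbour in level \<open>k\<close>.\<close>

lemma critical_subset_of_level:
  fixes E :: "'a \<Rightarrow> 'a \<Rightarrow> bool"
  assumes sym: "symp E"
    and tri: "\<forall>x y z. E x y \<longrightarrow> E y z \<longrightarrow> \<not> E x z"
    and V: "finite V" "\<not> colourable E V (2 * c)" and c: "0 < c"
  obtains W where "W \<subseteq> V" "\<not> colourable E W c" "\<And>w. w \<in> W \<Longrightarrow> colourable E (W - {w}) c"
    "\<And>w. w \<in> W \<Longrightarrow> \<exists>p q. E p w \<and> E p q \<and> (\<forall>v\<in>W. \<not> E q v)"
proof -
  obtain d :: "'a \<Rightarrow> nat" where "\<forall>u v. E u v \<longrightarrow> d v \<le> Suc (d u)"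
    "\<forall>v k. d v = Suc k \<longrightarrow> (\<exists>u. E u v \<and> d u = k)"
    "\<forall>u v. E u v \<longrightarrow> d u = d v \<longrightarrow> 2 \<le> d u"
    using level_function[of E, OF sym tri] by (elim exE conjE)
  then have d: "\<And>u v. E u v \<Longrightarrow> d v \<le> Suc (d u)"
    "\<And>v k. d v = Suc k \<Longrightarrow> \<exists>u. E u v \<and> d u = k"
    "\<And>u v. E u v \<Longrightarrow> d u = d v \<Longrightarrow> 2 \<le> d u"
    by blast+
  obtain k where k: "\<not> colourable E {v \<in> V. d v = k} c"
    using colourable_of_levels[of E d, OF sym d(1)] V(2) by metis
  have "2 \<le> k"
  proof (rule ccontr)
    assume "\<not> 2 \<le> k"
    then have "\<not> E u v" if "u \<in> {v \<in> V. d v = k}" "v \<in> {v \<in> V. d v = k}" for u v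
      using that d(3)[of u v] by auto
    then show False
      using k colourable_stable[OF _ c] by blast
  qed
  obtain W where W: "W \<subseteq> {v \<in> V. d v = k}" "\<not> colourable E W c"
    "\<And>w. w \<in> W \<Longrightarrow> colourable E (W - {w}) c"
    using critical_subset[OF _ k] V(1) by auto
  have "\<exists>p q. E p w \<and> E p q \<and> (\<forall>v\<in>W. \<not> E q v)" if "w \<in> W" for w
  proof -
    obtain j where j: "k = Suc (Suc j)"
      using \<open>2 \<le> k\<close> by (metis add_2_eq_Suc le_Suc_ex)
    have "d w = Suc (Suc j)"
      using W(1) that j by auto
    then obtain p where p: "E p w" "d p = Suc j"
      using d(2) by auto
    then obtain q where q: "E q p" "d q = j"
      using d(2) by auto
    have "\<not> E q v" if "v \<in> W" for v
      using d(1)[of q v] q(2) j W(1) that by fastforce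
    then show ?thesis
      using p(1) sympD[OF sym q(1)] by blast
  qed
  then show thesis
    using that[of W] W by blast
qed

text \<open>Fewer than \<open>c\<close> neighbours would leave one of the \<open>c\<close> colours
  free for \<open>w\<close>.\<close>

lemma critical_degree:
  assumes sym: "symp E" and irrefl: "\<not> E w w" and "finite W"
    and W: "\<not> colourable E W c" "colourable E (W - {w}) c"
  shows "c \<le> card {v \<in> W. E w v}"
proof (rule ccontr)
  assume less: "\<not> ?thesis"
  obtain \<phi> where \<phi>: "\<forall>v\<in>W - {w}. \<phi> v < c"
    "\<forall>u\<in>W - {w}. \<forall>v\<in>W - {w}. E u v \<longrightarrow> \<phi> u \<noteq> \<phi> v"
    using W(2) unfolding colourable_def by blast
  have "card (\<phi> ` {v \<in> W. E w v}) < card {..<c}"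
    using less card_image_le[of "{v \<in> W. E w v}" \<phi>] \<open>finite W\<close> by simp
  then have "\<not> {..<c} \<subseteq> \<phi> ` {v \<in> W. E w v}"
    using card_mono[of "\<phi> ` {v \<in> W. E w v}" "{..<c}"] \<open>finite W\<close> by force
  then obtain i where "i < c" "i \<notin> \<phi> ` {v \<in> W. E w v}"
    by blast
  then have "colourable E W c"
    by (intro colourable_insert[of E, OF sym irrefl \<phi>]) auto
  then show False
    using W(1) by blast
qed

text \<open>If \<open>y\<close> were adjacent to all neighbours of \<open>x\<close> in
  \<open>W\<close>, then \<open>x\<close> could take the colour of \<open>y\<close>.\<close>

lemma critical_private_neighbour:
  assumes sym: "symp E" and irrefl: "\<not> E x x"
    and W: "\<not> colourable E W c" "colourable E (W - {x}) c"
    and y: "y \<in> W" "x \<noteq> y"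
  shows "\<exists>z\<in>W. E x z \<and> \<not> E y z"
proof (rule ccontr)
  assume sub: "\<not> ?thesis"
  obtain \<phi> where \<phi>: "\<forall>v\<in>W - {x}. \<phi> v < c"
    "\<forall>u\<in>W - {x}. \<forall>v\<in>W - {x}. E u v \<longrightarrow> \<phi> u \<noteq> \<phi> v"
    using W(2) unfolding colourable_def by blast
  have "\<phi> v \<noteq> \<phi> y" if "v \<in> W" "E x v" for v
  proof -
    have "E y v" "v \<noteq> x"
      using sub that irrefl by auto
    then show ?thesis
      using \<phi>(2) y that(1) by fastforce
  qed
  then have "colourable E W c"
    using \<phi>(1) y by (intro colourable_insert[of E, OF sym irrefl \<phi>, of "\<phi> y"]) auto
  then show False
    using W(1) by blast
qed

lemma critical_colourable_Suc:
  assumes sym: "symp E" and irrefl: "\<not> E w w"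
    and "colourable E (W - {w}) c"
  shows "colourable E W (Suc c)"
proof -
  obtain \<phi> where \<phi>: "\<forall>v\<in>W - {w}. \<phi> v < c"
    "\<forall>u\<in>W - {w}. \<forall>v\<in>W - {w}. E u v \<longrightarrow> \<phi> u \<noteq> \<phi> v"
    using assms(3) unfolding colourable_def by blast
  then have "\<forall>v\<in>W - {w}. \<phi> v < Suc c"
    by (simp add: less_SucI)
  moreover have "\<forall>v\<in>W. E w v \<longrightarrow> \<phi> v \<noteq> c"
    using \<phi>(1) irrefl by force
  ultimately show ?thesis
    by (intro colourable_insert[of E, OF sym irrefl _ \<phi>(2), of "Suc c" c]) auto
qed

section \<open>Recognising sunspots in triangle-free graphs\<close>

text \<open>Of the 21 pairs, seven are edges and six are non-edges by \<open>N\<close>. The other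
  eight pairs, listed in \<open>T\<close>, have a common neighbour among the \<open>x\<close>
  vertices, so triangle-freeness makes them non-edges.\<close>

lemma four_sunspotI:
  assumes sym: "symp (\<lambda>u v. (u, v) \<in> parcs G)"
    and tri: "\<forall>x y z. (x, y) \<in> parcs G \<longrightarrow> (y, z) \<in> parcs G \<longrightarrow> (x, z) \<notin> parcs G"
    and wf: "\<forall>u v. (u, v) \<in> parcs G \<longrightarrow> u \<in> pverts G"
    and E: "(x1, x2) \<in> parcs G" "(x2, x3) \<in> parcs G" "(x3, x4) \<in> parcs G" "(x4, x1) \<in> parcs G"
      "(x1, y1) \<in> parcs G" "(x2, y2) \<in> parcs G" "(x3, y3) \<in> parcs G"
    and N: "(y1, x3) \<notin> parcs G" "(y2, x4) \<notin> parcs G" "(y3, x1) \<notin> parcs G"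
      "(y1, y2) \<notin> parcs G" "(y2, y3) \<notin> parcs G" "(y1, y3) \<notin> parcs G"
  shows "four_sunspot G x1 x2 x3 x4 y1 y2 y3"
proof -
  have s: "(v, u) \<in> parcs G" if "(u, v) \<in> parcs G" for u v
    using sympD[OF sym that] .
  have ns: "(v, u) \<notin> parcs G" if "(u, v) \<notin> parcs G" for u v
    using s that by auto
  have irrefl: "(u, u) \<notin> parcs G" for u
    using tri by auto
  note E' = E E[THEN s]
  have T: "(x1, x3) \<notin> parcs G" "(x2, x4) \<notin> parcs G" "(y1, x2) \<notin> parcs G" "(y1, x4) \<notin> parcs G"
    "(y2, x1) \<notin> parcs G" "(y2, x3) \<notin> parcs G" "(y3, x2) \<notin> parcs G" "(y3, x4) \<notin> parcs G"
    using tri E' by meson+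
  note N' = N N[THEN ns] T T[THEN ns] irrefl
  let ?S = "{x1, x2, x3, x4, y1, y2, y3}"
  let ?T = "{{x1, x2}, {x2, x3}, {x3, x4}, {x4, x1}, {x1, y1}, {x2, y2}, {x3, y3}}"
  \<comment> \<open>Each non-adjacent pair is told apart by a third vertex \<open>w\<close>,
    supplied below for every pair in \<open>D\<close>; adjacent pairs differ by
    \<open>irrefl\<close>.\<close>
  have neq: "u \<noteq> v" if "(u, w) \<in> parcs G" "(v, w) \<notin> parcs G" for u v w
    using that by auto
  have D: "x1 \<noteq> x3" "x2 \<noteq> x4" "x1 \<noteq> y2" "x1 \<noteq> y3" "x2 \<noteq> y1"
    "x2 \<noteq> y3" "x3 \<noteq> y1" "x3 \<noteq> y2" "x4 \<noteq> y1" "x4 \<noteq> y2"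
    "x4 \<noteq> y3" "y1 \<noteq> y2" "y1 \<noteq> y3" "y2 \<noteq> y3"
    by (rule neq[of _ y1], rule E', rule N', rule neq[of _ y2], rule E', rule N',
      rule neq[of _ x4], rule E', rule N', rule neq[of _ x4], rule E', rule N',
      rule neq[of _ x3], rule E', rule N', rule neq[of _ x1], rule E', rule N',
      rule neq[of _ x4], rule E', rule N', rule neq[of _ x4], rule E', rule N',
      rule neq[of _ x3], rule E', rule N', rule neq[of _ x3], rule E', rule N',
      rule neq[of _ x1], rule E', rule N', rule neq[of _ x1], rule E', rule N',
      rule neq[of _ x1], rule E', rule N', rule neq[of _ x2], rule E', rule N')
  have T_edge: "{u, v} \<in> ?T" if "u \<in> ?S" "v \<in> ?S" "(u, v) \<in> parcs G" for u v
    using that(1,2) by (elim insertE emptyE; use that(3) in \<open>simp add: N' doubleton_eq_iff\<close>)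
  have "distinct [x1, x2, x3, x4, y1, y2, y3]"
    using E irrefl D by auto
  moreover have "?S \<subseteq> pverts G"
    using wf E' by blast
  moreover have "{e \<in> edges G. e \<subseteq> ?S} \<subseteq> ?T"
  proof (intro subsetI)
    fix e assume "e \<in> {e \<in> edges G. e \<subseteq> ?S}"
    then have e: "e \<in> edges G" "e \<subseteq> ?S"
      by (simp_all only: mem_Collect_eq)
    then obtain u v where uv: "e = {u, v}" "(u, v) \<in> parcs G"
      unfolding edges_def by blast
    then have "u \<in> ?S" "v \<in> ?S"
      using e(2) by (simp_all only: insert_subset)
    then show "e \<in> ?T"
      unfolding uv(1) using uv(2) by (rule T_edge)
  qed
  moreover have "?T \<subseteq> {e \<in> edges G. e \<subseteq> ?S}"
  proof -
    have "{u, v} \<in> edges G" if "(u, v) \<in> parcs G" for u v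
      using that unfolding edges_def by blast
    then show ?thesis
      using E by simp
  qed
  ultimately show ?thesis
    unfolding four_sunspot_def by (intro conjI equalityI)
qed

section \<open>Cycles and holes through cyclic indices\<close>

lemma shift_mod_eq_iff:
  fixes a k l n :: nat
  assumes "k < n" "l < n"
  shows "(a + k) mod n = (a + l) mod n \<longleftrightarrow> k = l"
proof -
  have *: "k' = l'" if "(a + k') mod n = (a + l') mod n" "k' \<le> l'" "l' < n" for k' l'
  proof -
    have "n dvd (a + l') - (a + k')"
      using that mod_eq_dvd_iff_nat[of "a + k'" "a + l'" n] by simp
    then show ?thesis
      using that by (auto dest: dvd_imp_le)
  qed
  show ?thesis
    using *[of k l] *[of l k] assms by (cases "k \<le> l") auto
qed

text \<open>Two indices giving the same edge would have their ends swapped, so that 2 is 0 modulo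
  \<open>n\<close>, against \<open>3 \<le> n\<close>. Hence the length of a hole is the
  \<open>n\<close> of its parametrisation.\<close>

lemma cycle_edge_inj_on:
  assumes f: "inj_on f {..<n}" and n: "3 \<le> (n :: nat)"
  shows "inj_on (\<lambda>i. {f i, f (Suc i mod n)}) {..<n}"
proof (rule inj_onI)
  fix i j assume i: "i \<in> {..<n}" and j: "j \<in> {..<n}"
    and eq: "{f i, f (Suc i mod n)} = {f j, f (Suc j mod n)}"
  have m: "Suc i mod n \<in> {..<n}" "Suc j mod n \<in> {..<n}"
    using n by auto
  show "i = j"
  proof (rule ccontr)
    assume "i \<noteq> j"
    then have "f i \<noteq> f j"
      using f i j by (auto dest: inj_onD)
    then have "f i = f (Suc j mod n)" "f j = f (Suc i mod n)"
      using eq by (auto simp: doubleton_eq_iff)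
    then have ij: "i = Suc j mod n" "j = Suc i mod n"
      using f i j m by (auto dest: inj_onD)
    then have "(i + 2) mod n = (i + 0) mod n"
      using i by (metis add_0_right add_2_eq_Suc' lessThan_iff mod_Suc_eq mod_less)
    then show False
      using shift_mod_eq_iff[of 2 n 0 i] n by simp
  qed
qed

lemma cycle_graph_obtain:
  assumes "cycle_graph H"
  obtains n f where "n = card (edges H)" "3 \<le> n" "bij_betw f {..<n} (pverts H)"
    "edges H = {{f i, f (Suc i mod n)} |i. i < n}"
proof -
  obtain n f where n: "3 \<le> n" and f: "bij_betw f {..<n} (pverts H)"
    and e: "edges H = {{f i, f (Suc i mod n)} |i. i < n}"
    using assms unfolding cycle_graph_def by blast
  have "edges H = (\<lambda>i. {f i, f (Suc i mod n)}) ` {..<n}"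
    unfolding e by auto
  then have "card (edges H) = n"
    using card_image[OF cycle_edge_inj_on[OF _ n, of f]] bij_betw_imp_inj_on[OF f] by simp
  then show thesis
    using that[OF _ n f e] by simp
qed

text \<open>Depending on its orientation, such an edge would make \<open>k\<close> congruent to 1 or
  \<open>k + 1\<close> congruent to 0 modulo \<open>n\<close>, and all these offsets lie below
  \<open>n\<close>.\<close>

lemma cycle_chord_not_edge:
  assumes f: "inj_on f {..<n}" and n: "1 < (n :: nat)" and k: "2 \<le> k" "k + 1 < n"
  shows "{f (m mod n), f ((m + k) mod n)} \<notin> {{f i, f (Suc i mod n)} |i. i < n}"
proof
  assume "{f (m mod n), f ((m + k) mod n)} \<in> {{f i, f (Suc i mod n)} |i. i < n}"
  then obtain i where i: "i < n" "{f (m mod n), f ((m + k) mod n)} = {f i, f (Suc i mod n)}"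
    by auto
  have inj: "a = b" if "f a = f b" "a < n" "b < n" for a b
    using f that by (auto dest: inj_onD)
  have lt: "m mod n < n" "(m + k) mod n < n" "Suc i mod n < n"
    using n by auto
  consider "m mod n = i" "(m + k) mod n = Suc i mod n" | "m mod n = Suc i mod n" "(m + k) mod n = i"
    using i lt inj by (metis doubleton_eq_iff)
  then show False
  proof cases
    case 1
    then have "(m + k) mod n = (m + 1) mod n"
      by (metis Suc_eq_plus1 mod_Suc_eq)
    then show False
      using shift_mod_eq_iff[of k n 1 m] k by simp
  next
    case 2
    then have "(m + 0) mod n = (m + (k + 1)) mod n"
      by (metis Suc_eq_plus1 add.assoc add_0_right mod_Suc_eq)
    then show False
      using shift_mod_eq_iff[of 0 n "k + 1" m] k by simp
  qed
qed

text \<open>Length at least 6 ensures \<open>k + 1 < n\<close> for offsets up to 4, so these are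
  chords of the cycle and, the hole being induced, non-edges of \<open>L\<close>. Nine consecutive
  values of \<open>h\<close> repeat vertices when the length is below 9; this is harmless, since
  only five at a time have to form a path.\<close>

lemma hole_walk:
  assumes sym: "symp (\<lambda>u v. (u, v) \<in> parcs L)"
    and H: "hole L H" "6 \<le> hole_length H" and e: "e \<in> edges H"
  obtains h :: "nat \<Rightarrow> 'a" where "e = {h 3, h 4}" "\<And>i. h i \<in> pverts L"
    "\<And>i. (h i, h (i + 1)) \<in> parcs L"
    "\<And>i k. 2 \<le> k \<Longrightarrow> k \<le> 4 \<Longrightarrow> (h i, h (i + k)) \<notin> parcs L"
proof -
  have ind: "pverts H \<subseteq> pverts L" "parcs H = {e \<in> parcs L. fst e \<in> pverts H \<and> snd e \<in> pverts H}"
    using H(1) unfolding hole_def induced_subgraph_def subgraph_def by auto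
  have "cycle_graph H"
    using H(1) unfolding hole_def by blast
  then obtain n f where n: "n = card (edges H)" and f: "bij_betw f {..<n} (pverts H)"
    and E: "edges H = {{f i, f (Suc i mod n)} |i. i < n}"
    by (rule cycle_graph_obtain)
  have n6: "6 \<le> n"
    using n H(2) unfolding hole_length_def by simp
  obtain j where j: "j < n" "e = {f j, f (Suc j mod n)}"
    using e unfolding E by auto
  \<comment> \<open>The walk runs around the cycle periodically, with \<open>e\<close> placed in the middle of nine vertices.\<close>
  define h where "h i = f ((i + (j + n - 3)) mod n)" for i
  have hH: "h i \<in> pverts H" for i
    using f n6 unfolding h_def bij_betw_def by auto
  \<comment> \<open>The summand \<open>n\<close> keeps the subtraction of 3 from being truncated
    when \<open>j\<close> is small, and vanishes modulo \<open>n\<close>.\<close>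
  have "3 + (j + n - 3) = j + n" "4 + (j + n - 3) = Suc j + n"
    using n6 by simp_all
  then have "e = {h 3, h 4}"
    using j unfolding h_def by (simp only: mod_add_self2 mod_less)
  moreover have "h i \<in> pverts L" for i
    using hH ind(1) by auto
  moreover have "(h i, h (i + 1)) \<in> parcs L" for i
  proof -
    have "(i + (j + n - 3)) mod n < n"
      using n6 by simp
    moreover have "h (i + 1) = f (Suc ((i + (j + n - 3)) mod n) mod n)"
      unfolding h_def by (simp add: mod_Suc_eq)
    ultimately have "{h i, h (i + 1)} \<in> edges H"
      unfolding E by (auto simp: h_def)
    then have "(h i, h (i + 1)) \<in> parcs L \<or> (h (i + 1), h i) \<in> parcs L"
      unfolding edges_def ind(2) by (auto simp: doubleton_eq_iff)
    then show ?thesis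
      using sympD[OF sym] by auto
  qed
  moreover have "(h i, h (i + k)) \<notin> parcs L" if k: "2 \<le> k" "k \<le> 4" for i k
  proof
    assume "(h i, h (i + k)) \<in> parcs L"
    then have "{h i, h (i + k)} \<in> edges H"
      using hH unfolding edges_def ind(2) by auto
    moreover have "h i = f ((i + (j + n - 3)) mod n)" "h (i + k) = f ((i + (j + n - 3) + k) mod n)"
      unfolding h_def by (simp_all add: ac_simps)
    ultimately have "{f ((i + (j + n - 3)) mod n), f ((i + (j + n - 3) + k) mod n)} \<in> edges H"
      by metis
    moreover have "1 < n" "k + 1 < n"
      using k n6 by simp_all
    ultimately show False
      using cycle_chord_not_edge[OF bij_betw_imp_inj_on[OF f] _ k(1), of "i + (j + n - 3)"]
      unfolding E by blast
  qed
  ultimately show thesis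
    using that by blast
qed

lemma cycle_of_four_edges:
  assumes "cycle_graph F" "card (edges F) = 4" "{c, d} \<in> edges F"
  shows "\<exists>s t. {d, s} \<in> edges F \<and> {s, t} \<in> edges F \<and> {t, c} \<in> edges F \<and> s \<noteq> c \<and> t \<noteq> d"
proof -
  obtain n f where n: "n = card (edges F)" and f: "bij_betw f {..<n} (pverts F)"
    and E: "edges F = {{f i, f (Suc i mod n)} |i. i < n}"
    using assms(1) by (rule cycle_graph_obtain)
  have "n = 4"
    using n assms(2) by simp
  have inj: "f a \<noteq> f b" if "a \<noteq> b" "a < 4" "b < 4" for a b
    using bij_betw_imp_inj_on[OF f] that \<open>n = 4\<close> by (auto dest: inj_onD)
  have m: "Suc 0 mod 4 = (1 :: nat)" "Suc 1 mod 4 = (2 :: nat)" "Suc 2 mod 4 = (3 :: nat)" "Suc 3 mod 4 = (0 :: nat)"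
    by simp_all
  have step: "{f i, f (Suc i mod 4)} \<in> edges F" if "i < 4" for i
    using that \<open>n = 4\<close> unfolding E by blast
  have e: "{f 0, f 1} \<in> edges F" "{f 1, f 2} \<in> edges F" "{f 2, f 3} \<in> edges F" "{f 3, f 0} \<in> edges F"
    by (rule step[of 0, unfolded m] step[of 1, unfolded m] step[of 2, unfolded m] step[of 3, unfolded m], simp)+
  have neq: "f 0 \<noteq> f 2" "f 1 \<noteq> f 3" "f 2 \<noteq> f 0" "f 3 \<noteq> f 1"
    by (rule inj, simp, simp, simp)+
  obtain i where i: "i < 4" "{c, d} = {f i, f (Suc i mod 4)}"
    using assms(3) \<open>n = 4\<close> unfolding E by blast
  \<comment> \<open>The set \<open>{c, d}\<close> does not fix an orientation; if it runs against
    \<open>{a, b}\<close>, then \<open>s\<close> and \<open>t\<close> swap roles.\<close>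
  have close: ?thesis if cd: "{c, d} = {a, b}" and that: "{b, s} \<in> edges F" "{s, t} \<in> edges F" "{t, a} \<in> edges F"
    "a \<noteq> s" "b \<noteq> t" for a b s t
  proof -
    have rev: "{s, b} \<in> edges F" "{t, s} \<in> edges F" "{a, t} \<in> edges F"
      using that(1-3) by (simp_all only: insert_commute)
    consider "c = a" "d = b" | "c = b" "d = a"
      using cd unfolding doubleton_eq_iff by blast
    then show ?thesis
    proof cases
      case 1
      then show ?thesis
        using that by (intro exI[of _ s] exI[of _ t]) simp
    next
      case 2
      then show ?thesis
        using rev that(4,5) by (intro exI[of _ t] exI[of _ s]) simp
    qed
  qed
  consider "i = 0" | "i = 1" | "i = 2" | "i = 3"
    using i(1) by linarith
  then show ?thesis
  proof cases
    case 1
    show ?thesis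
      by (rule close[OF i(2)[unfolded 1 m] e(2,3,4) neq(1,2)])
  next
    case 2
    show ?thesis
      by (rule close[OF i(2)[unfolded 2 m] e(3,4,1) neq(2,3)])
  next
    case 3
    show ?thesis
      by (rule close[OF i(2)[unfolded 3 m] e(4,1,2) neq(3,4)])
  next
    case 4
    show ?thesis
      by (rule close[OF i(2)[unfolded 4 m] e(1,2,3) neq(4,1)])
  qed
qed

section \<open>Induced subgraphs, their chromatic number and flaplessness\<close>

definition induced :: "'a pair_pre_digraph \<Rightarrow> 'a set \<Rightarrow> 'a pair_pre_digraph" where
  "induced G W = \<lparr>pverts = W, parcs = {e \<in> parcs G. fst e \<in> W \<and> snd e \<in> W}\<rparr>"

lemma induced_simps [simp]:
  "pverts (induced G W) = W"
  "(u, v) \<in> parcs (induced G W) \<longleftrightarrow> (u, v) \<in> parcs G \<and> u \<in> W \<and> v \<in> W"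
  by (simp_all add: induced_def)

lemma induced_subgraph_induced:
  assumes "pair_wf_digraph G" "W \<subseteq> pverts G"
  shows "induced_subgraph (with_proj (induced G W)) (with_proj G)"
proof -
  have "pair_wf_digraph (induced G W)"
    unfolding pair_wf_digraph_def by (auto simp: induced_def)
  then show ?thesis
    using assms unfolding induced_subgraph_def subgraph_def compatible_def
    by (auto simp: wf_digraph_wp_iff induced_def)
qed

lemma ex_proper_colouring_induced_iff:
  "(\<exists>\<phi>. proper_colouring (induced G W) k \<phi>) \<longleftrightarrow> colourable (\<lambda>u v. (u, v) \<in> parcs G) W k"
proof -
  have "proper_colouring (induced G W) k \<phi> \<longleftrightarrow> (\<forall>v\<in>W. \<phi> v < k) \<and>
      (\<forall>u\<in>W. \<forall>v\<in>W. (u, v) \<in> parcs G \<longrightarrow> \<phi> u \<noteq> \<phi> v)" for \<phi>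
    unfolding proper_colouring_def by (auto simp: induced_def)
  then show ?thesis
    unfolding colourable_def by simp
qed

lemma chromatic_number_induced_eq:
  assumes "colourable (\<lambda>u v. (u, v) \<in> parcs G) W (Suc c)" "\<not> colourable (\<lambda>u v. (u, v) \<in> parcs G) W c"
  shows "chromatic_number (induced G W) = Suc c"
  unfolding chromatic_number_def ex_proper_colouring_induced_iff
proof (rule Least_equality)
  fix k assume "colourable (\<lambda>u v. (u, v) \<in> parcs G) W k"
  then show "Suc c \<le> k"
    using assms(2) colourable_mono[of _ W k c] by (cases "k \<le> c") auto
qed (rule assms(1))

lemma hole_edgeD:
  assumes "symp (\<lambda>u v. (u, v) \<in> parcs L)" "hole L H" "{u, v} \<in> edges H"
  shows "(u, v) \<in> parcs L"
proof -
  have "parcs H \<subseteq> parcs L"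
    using assms(2) unfolding hole_def induced_subgraph_def subgraph_def by simp
  moreover have "(u, v) \<in> parcs H \<or> (v, u) \<in> parcs H"
    using assms(3) unfolding edges_def by (auto simp: doubleton_eq_iff)
  ultimately show ?thesis
    using sympD[OF assms(1)] by blast
qed

lemma flapless_induced:
  assumes "sunspot_free_level (\<lambda>u v. (u, v) \<in> parcs G) W"
  shows "flapless (induced G W)"
  unfolding flapless_def
proof (intro allI impI notI)
  fix H
  assume "hole (induced G W) H \<and> 6 \<le> hole_length H" "\<exists>F. flap (induced G W) H F"
  then obtain F e where H: "hole (induced G W) H" "6 \<le> hole_length H"
    and F: "hole (induced G W) F" "hole_length F = 4" and e: "e \<in> edges F" "e \<in> edges H"
    unfolding flap_def by blast
  interpret sunspot_free_level "\<lambda>u v. (u, v) \<in> parcs G" W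
    by (rule assms)
  have symL: "symp (\<lambda>u v. (u, v) \<in> parcs (induced G W))"
    using sym by (intro sympI) simp
  obtain h :: "nat \<Rightarrow> 'a" where h: "e = {h 3, h 4}" "\<And>i. h i \<in> pverts (induced G W)"
    "\<And>i. (h i, h (i + 1)) \<in> parcs (induced G W)"
    "\<And>i k. 2 \<le> k \<Longrightarrow> k \<le> 4 \<Longrightarrow> (h i, h (i + k)) \<notin> parcs (induced G W)"
    using hole_walk[OF symL H e(2)] by blast
  have P: "P5 (h i) (h (i + 1)) (h (i + 2)) (h (i + 3)) (h (i + 4))" for i
  proof -
    have W: "h j \<in> W" for j
      using h(2) by simp
    have E: "(h j, h k) \<in> parcs G" if "k = j + 1" for j k
      using h(3)[of j] that by simp
    have N: "(h j, h k) \<notin> parcs G" if "j + 2 \<le> k" "k \<le> j + 4" for j k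
      using h(4)[of "k - j" j] W that by simp
    show ?thesis
      unfolding P5_def by (intro conjI E N) (simp_all add: W)
  qed
  obtain s t where st: "{h 4, s} \<in> edges F" "{s, t} \<in> edges F" "{t, h 3} \<in> edges F" "s \<noteq> h 3" "t \<noteq> h 4"
    using cycle_of_four_edges[of F "h 3" "h 4"] F e(1) h(1) unfolding hole_def hole_length_def by blast
  then have "(h 4, s) \<in> parcs (induced G W)" "(s, t) \<in> parcs (induced G W)" "(t, h 3) \<in> parcs (induced G W)"
    using hole_edgeD[OF symL F(1)] by blast+
  then have st_adj: "s \<in> W" "t \<in> W" "(h 4, s) \<in> parcs G" "(s, t) \<in> parcs G" "(t, h 3) \<in> parcs G"
    by simp_all
  \<comment> \<open>The five windows of the walk that contain \<open>h 4\<close>; the shared edge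
    \<open>{h 3, h 4}\<close> plays the role of \<open>c d\<close> in
    \<open>no_four_cycle_on_hole_edge\<close>.\<close>
  have "P5 (h 0) (h 1) (h 2) (h 3) (h 4)" "P5 (h 1) (h 2) (h 3) (h 4) (h 5)"
    "P5 (h 2) (h 3) (h 4) (h 5) (h 6)" "P5 (h 3) (h 4) (h 5) (h 6) (h 7)" "P5 (h 4) (h 5) (h 6) (h 7) (h 8)"
    using P[of 0] P[of 1] P[of 2] P[of 3] P[of 4] by (simp_all add: numeral_eq_Suc)
  then show False
    by (rule no_four_cycle_on_hole_edge[OF _ _ _ _ _ st_adj st(4,5)])
qed

theorem theorem2p1:
  fixes G :: "'a pair_pre_digraph" and c :: nat
  assumes "0 < c"
    and "pair_graph G"
    and "triangle_free G"
    and "four_sunspot_free G"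
    and "chromatic_number G > 2 * c + 1"
  shows "\<exists>L. induced_subgraph (with_proj L) (with_proj G) \<and> chromatic_number L = c + 1 \<and>
           non_degenerate L \<and> liberal L \<and> flapless L"
proof -
  let ?E = "\<lambda>u v. (u, v) \<in> parcs G"
  interpret pair_graph G
    by (rule assms(2))
  have sym: "symp ?E"
    using pair_sym_arcs unfolding symmetric_def by (auto intro: sympI dest: symD)
  have tri: "\<forall>x y z. ?E x y \<longrightarrow> ?E y z \<longrightarrow> \<not> ?E x z"
    using assms(3) sympD[OF sym] unfolding triangle_free_def by blast
  then have irrefl: "\<not> ?E x x" for x
    by blast
  have wf: "\<forall>u v. ?E u v \<longrightarrow> u \<in> pverts G"
    using arc_fst_in_verts by fastforce
  have "\<not> colourable ?E (pverts G) (2 * c)"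
  proof
    assume "colourable ?E (pverts G) (2 * c)"
    then obtain \<phi> where \<phi>: "\<forall>v\<in>pverts G. \<phi> v < 2 * c"
      "\<forall>u\<in>pverts G. \<forall>v\<in>pverts G. ?E u v \<longrightarrow> \<phi> u \<noteq> \<phi> v"
      unfolding colourable_def by blast
    have "proper_colouring G (2 * c) \<phi>"
      using \<phi> wf sympD[OF sym] unfolding proper_colouring_def by blast
    then have "chromatic_number G \<le> 2 * c"
      unfolding chromatic_number_def by (intro Least_le exI)
    then show False
      using assms(5) by simp
  qed
  then obtain W where W: "W \<subseteq> pverts G" "\<not> colourable ?E W c"
    "\<And>w. w \<in> W \<Longrightarrow> colourable ?E (W - {w}) c"
    "\<And>w. w \<in> W \<Longrightarrow> \<exists>p q. ?E p w \<and> ?E p q \<and> (\<forall>v\<in>W. \<not> ?E q v)"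
    using critical_subset_of_level[OF sym tri pair_finite_verts _ assms(1)] by blast
  have fin: "finite W"
    using W(1) pair_finite_verts finite_subset by blast
  \<comment> \<open>The empty set is colourable with any number of colours. A vertex of
    \<open>W\<close> is needed to colour \<open>W\<close> with one colour more than
    \<open>W - {w}\<close>.\<close>
  have "W \<noteq> {}"
    using W(2) unfolding colourable_def by auto
  then have "colourable ?E W (Suc c)"
    using critical_colourable_Suc[OF sym irrefl] W(3) by blast
  then have chi: "chromatic_number (induced G W) = Suc c"
    using chromatic_number_induced_eq W(2) by blast
  have private_nbr: "\<exists>z\<in>W. ?E x z \<and> \<not> ?E y z" if "x \<in> W" "y \<in> W" "x \<noteq> y" for x y
    using critical_private_neighbour[OF sym irrefl W(2,3)] that by blast
  have "non_degenerate (induced G W)"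
  proof -
    have "neighbourhood (induced G W) w = {v \<in> W. ?E w v}" if "w \<in> W" for w
      using that unfolding neighbourhood_def by auto
    then show ?thesis
      using critical_degree[OF sym irrefl fin W(2,3)] chi
      unfolding non_degenerate_def degree_def by simp
  qed
  moreover have "liberal (induced G W)"
    unfolding liberal_def neighbourhood_def using private_nbr by fastforce
  \<comment> \<open>The relation is that of \<open>G\<close> and not of the induced subgraph: the
    pendants \<open>p\<close> and \<open>q\<close> come from lower levels, so the sunspots live in
    \<open>G\<close>.\<close>
  moreover have "sunspot_free_level ?E W"
  proof
    show "?E y x" if "?E x y" for x y
      using sympD[OF sym that] .
    show "\<not> ?E x z" if "?E x y" "?E y z" for x y z
      using tri that by blast
    show "\<exists>p q. ?E p w \<and> ?E p q \<and> (\<forall>v\<in>W. \<not> ?E q v)" if "w \<in> W" for w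
      using W(4)[OF that] .
    show "\<exists>z\<in>W. ?E x z \<and> \<not> ?E y z" if "x \<in> W" "y \<in> W" "x \<noteq> y" "\<not> ?E x y" for x y
      using private_nbr[OF that(1-3)] .
  next
    fix x1 x2 x3 x4 y1 y2 y3
    assume E: "?E x1 x2" "?E x2 x3" "?E x3 x4" "?E x4 x1" "?E x1 y1" "?E x2 y2" "?E x3 y3"
      "\<not> ?E y1 x3" "\<not> ?E y2 x4" "\<not> ?E y3 x1" "\<not> ?E y1 y2" "\<not> ?E y2 y3" "\<not> ?E y1 y3"
    show False
      using four_sunspotI[OF sym tri wf E] assms(4) unfolding four_sunspot_free_def by blast
  qed
  then have "flapless (induced G W)"
    by (rule flapless_induced)
  moreover have "induced_subgraph (with_proj (induced G W)) (with_proj G)"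
    using induced_subgraph_induced[OF _ W(1)] pair_wf_digraph_axioms by blast
  ultimately show ?thesis
    using chi by (intro exI[of _ "induced G W"]) simp
qed

end
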